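(* $N(96) \ge 10$; that is, there exist $10$ mutually orthogonal Latin squares of order $96$.
   Context: Let $n$ be a positive integer. A Latin square of order $n$ on an $n$-element set $V$ is an $n \times n$ array with entries in $V$ such that every row and every column is a permutation of $V$. Two Latin squares $L_1=(v_{ij})$ on $V$ and $L_2=(w_{ij})$ on $W$ (with $|V|=|W|=n$) are called orthogonal if the set of all entries of the array $((v_{ij},w_{ij}))$ is the whole Cartesian product $V\times W$. A set of $t$ mutually orthogonal Latin squares (MOLS) of order $n$ consists of $t$ Latin squares of order $n$ which are pairwise orthogonal. $N(n)$ denotes the size of the largest set of MOLS of order $n$. *)

theory Defs
  imports "HOL-Library.Extended_Nat"
begin

(* An n x n array is a function of a row and a column index, both in {..<n};
   its values outside this range are irrelevant. *)
definition latin_square :: "nat \<Rightarrow> 'a set \<Rightarrow> (nat \<Rightarrow> nat \<Rightarrow> 'a) \<Rightarrow> bool" where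
  "latin_square n V L \<longleftrightarrow>
     0 < n \<and> finite V \<and> card V = n \<and>
     (\<forall>i<n. bij_betw (\<lambda>j. L i j) {..<n} V) \<and>
     (\<forall>j<n. bij_betw (\<lambda>i. L i j) {..<n} V)"

definition orthogonal_squares ::
    "nat \<Rightarrow> 'a set \<Rightarrow> (nat \<Rightarrow> nat \<Rightarrow> 'a) \<Rightarrow> 'b set \<Rightarrow> (nat \<Rightarrow> nat \<Rightarrow> 'b) \<Rightarrow> bool" where
  "orthogonal_squares n V L W M \<longleftrightarrow>
     {(L i j, M i j) | i j. i < n \<and> j < n} = V \<times> W"

(* The squares L 0, ..., L (t - 1) may use different symbol sets V 0, ..., V (t - 1).
   For n > 1 orthogonality forces the squares to be distinct, so the family is
   the same thing as a set of t squares. *)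
definition mols :: "nat \<Rightarrow> nat \<Rightarrow> (nat \<Rightarrow> 'a set) \<Rightarrow> (nat \<Rightarrow> nat \<Rightarrow> nat \<Rightarrow> 'a) \<Rightarrow> bool" where
  "mols t n V L \<longleftrightarrow>
     (\<forall>k<t. latin_square n (V k) (L k)) \<and>
     (\<forall>k<t. \<forall>l<t. k \<noteq> l \<longrightarrow> orthogonal_squares n (V k) (L k) (V l) (L l))"

(* Natural-number symbols are no restriction, since symbol sets are finite.
   The value is taken in enat because the family sizes are unbounded for n = 1;
   for n > 1 there are at most n - 1 squares and the supremum is a maximum. *)
definition max_mols :: "nat \<Rightarrow> enat" where
  "max_mols n =
     Sup {enat t | t. \<exists>(V :: nat \<Rightarrow> nat set) (L :: nat \<Rightarrow> nat \<Rightarrow> nat \<Rightarrow> nat). mols t n V L}"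

end

theory Submission
  imports
    Defs
    "HOL-Library.Z2"
    "HOL-Library.Numeral_Type"
    "HOL-Library.Product_Plus"
begin

text \<open>
  Let \<open>G\<close> be an abelian group of order \<open>n\<close>. A difference matrix is a family of maps
  \<open>D\<^sub>0, \<dots>, D\<^sub>t\<close> from an \<open>n\<close>-element set of columns to \<open>G\<close> such that all differences
  \<open>D\<^sub>i - D\<^sub>j\<close> are bijections. It gives \<open>t\<close> mutually orthogonal Latin squares of order \<open>n\<close>,
  namely \<open>(x, y) \<mapsto> x + D\<^sub>k y - D\<^sub>0 y\<close> for \<open>1 \<le> k \<le> t\<close> (\<open>mols_of_difference_matrix\<close>).
  The theorem follows from a difference matrix with twelve rows over
  \<open>G = F\<^sub>2\<^sup>5 \<times> Z\<^sub>3\<close>; it yields eleven squares of order \<open>96\<close>, one more than required.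

  The matrix is built so that it is determined, and can be verified, by little data. The columns
  are the pairs \<open>(r, x)\<close> with \<open>r < 12\<close> and \<open>x\<close> in \<open>F\<^sub>2\<^sup>3\<close>, and each row is affine on the
  twelve cosets of \<open>F\<^sub>2\<^sup>3\<close>, with a linear part that is the same on all of them:
  \<open>D\<^sub>i (r, x) = (c\<^sub>i(r) + \<phi>\<^sub>i(x), h\<^sub>i(r))\<close>. Put \<open>\<psi> = \<phi>\<^sub>i - \<phi>\<^sub>j\<close>. Then \<open>D\<^sub>i - D\<^sub>j\<close> is
  bijective if \<open>\<psi>\<close> is injective and, for each \<open>u\<close> in \<open>Z\<^sub>3\<close>, the vectors \<open>c\<^sub>i(r) - c\<^sub>j(r)\<close>
  with \<open>h\<^sub>i(r) - h\<^sub>j(r) = u\<close> are distinct modulo the image of \<open>\<psi>\<close>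
  (\<open>bij_betw_affine_on_cosets\<close>).
  That image has index four in \<open>F\<^sub>2\<^sup>5\<close>, so each \<open>u\<close> can occur for at most four, hence for
  exactly four, of the twelve \<open>r\<close>: the residues \<open>h\<^sub>i(r)\<close> form a generalized Hadamard matrix
  of order \<open>12\<close> over \<open>Z\<^sub>3\<close>.

  Conversely, start from such a matrix with a group of symmetries that permutes rows and columns and
  is elementary abelian of order nine; require the maps \<open>\<phi>\<^sub>i\<close> and the vectors \<open>c\<^sub>i(r)\<close> to
  be invariant under it. Four distinct elements of the quotient, a Klein four-group, sum to zero,
  and for given \<open>\<phi>\<^sub>i\<close> this is a system of linear equations in the vectors \<open>c\<^sub>i(r)\<close>. Its
  solution space is small enough to be searched for a point at which the elements are indeed
  distinct. The table below is such a point, after a normalization that makes the first row and the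
  first column zero. For each of its 66 pairs of rows the condition concerns the seven nonzero
  vectors in the image of \<open>\<psi>\<close> and the 66 pairs of cosets, and is decided by rewriting
  (\<open>matrix_rows_compatible\<close>).
\<close>

section \<open>Latin squares from a difference matrix\<close>

lemma mols_antimono: "mols t n V L \<Longrightarrow> s \<le> t \<Longrightarrow> mols s n V L"
  by (auto simp: mols_def)

lemma bij_betw_minus_commute:
  fixes f g :: "'c \<Rightarrow> 'g::ab_group_add"
  assumes "bij_betw (\<lambda>y. f y - g y) C UNIV"
  shows "bij_betw (\<lambda>y. g y - f y) C UNIV"
proof -
  have "bij_betw (uminus \<circ> (\<lambda>y. f y - g y)) C UNIV"
    using assms by (rule bij_betw_trans) (rule bij_uminus)
  then show ?thesis
    by (simp add: comp_def)
qed

text \<open>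
  A prescribed pair of entries \<open>(s, s')\<close> of two of the squares determines its column \<open>y\<close>,
  since the row \<open>x\<close> cancels in the difference of the entries; then either entry determines
  \<open>x\<close>. The squares are indexed and filled with natural numbers through a bijection \<open>\<rho>\<close> from
  \<open>{..<n}\<close> to the group and a bijection \<open>\<kappa>\<close> from \<open>{..<n}\<close> to the columns.
\<close>

lemma mols_of_difference_matrix:
  fixes D :: "nat \<Rightarrow> 'c \<Rightarrow> 'g::{ab_group_add, finite}"
  assumes card_group: "CARD('g) = n" and card_columns: "finite C" "card C = n"
    and diff: "\<And>i j. i < j \<Longrightarrow> j \<le> t \<Longrightarrow> bij_betw (\<lambda>y. D i y - D j y) C UNIV"
  shows "\<exists>(V :: nat \<Rightarrow> nat set) L. mols t n V L"
proof -
  obtain \<rho> :: "nat \<Rightarrow> 'g" where \<rho>: "bij_betw \<rho> {..<n} UNIV"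
    using ex_bij_betw_nat_finite[of "UNIV :: 'g set"] card_group by (auto simp: atLeast0LessThan)
  obtain \<kappa> where \<kappa>: "bij_betw \<kappa> {..<n} C"
    using ex_bij_betw_nat_finite[OF card_columns(1)] card_columns(2) by (auto simp: atLeast0LessThan)
  define \<sigma> where "\<sigma> = inv_into {..<n} \<rho>"
  have \<sigma>: "bij_betw \<sigma> UNIV {..<n}"
    unfolding \<sigma>_def using \<rho> by (rule bij_betw_inv_into)
  have \<sigma>_\<rho>: "\<sigma> (\<rho> s) = s" if "s < n" for s
    unfolding \<sigma>_def using \<rho> that by (simp add: bij_betw_inv_into_left)
  have row_diff: "bij_betw (\<lambda>y. D i y - D j y) C UNIV" if "i \<noteq> j" "i \<le> t" "j \<le> t" for i j
    using that diff[of i j] bij_betw_minus_commute[OF diff[of j i]] by (cases i j rule: linorder_cases) auto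
  define a where "a k y = D (Suc k) y - D 0 y" for k y
  define L where "L k i j = \<sigma> (\<rho> i + a k (\<kappa> j))" for k i j
  have translation: "bij_betw (\<lambda>x. x + c) UNIV UNIV" "bij_betw (\<lambda>x. c + x) UNIV UNIV" for c :: 'g
    by (auto intro: bij_betw_byWitness[where f' = "\<lambda>x. x - c"])
  have "latin_square n {..<n} (L k)" if "k < t" for k
    unfolding latin_square_def
  proof (intro conjI allI impI)
    show "0 < n"
      using card_group by auto
  next
    fix i
    have "bij_betw (\<sigma> \<circ> ((\<lambda>x. \<rho> i + x) \<circ> (a k \<circ> \<kappa>))) {..<n} {..<n}"
      unfolding a_def using \<kappa> \<sigma> translation row_diff[of "Suc k" 0] that
      by (intro bij_betw_trans) auto
    then show "bij_betw (\<lambda>j. L k i j) {..<n} {..<n}"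
      by (simp add: L_def comp_def)
  next
    fix j
    have "bij_betw (\<sigma> \<circ> ((\<lambda>x. x + a k (\<kappa> j)) \<circ> \<rho>)) {..<n} {..<n}"
      using \<rho> \<sigma> translation by (intro bij_betw_trans) auto
    then show "bij_betw (\<lambda>i. L k i j) {..<n} {..<n}"
      by (simp add: L_def comp_def)
  qed auto
  moreover have "orthogonal_squares n {..<n} (L k) {..<n} (L l)" if "k < t" "l < t" "k \<noteq> l" for k l
    unfolding orthogonal_squares_def
  proof (intro equalityI subsetI)
    fix p assume "p \<in> {(L k i j, L l i j) | i j. i < n \<and> j < n}"
    then show "p \<in> {..<n} \<times> {..<n}"
      using \<sigma> unfolding L_def by (auto simp: bij_betw_def)
  next
    fix p assume "p \<in> {..<n} \<times> {..<n}"
    then obtain s s' where p: "p = (s, s')" "s < n" "s' < n"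
      by auto
    have "bij_betw (\<lambda>y. a k y - a l y) C UNIV"
      using row_diff[of "Suc k" "Suc l"] that by (simp add: a_def)
    then have "\<rho> s - \<rho> s' \<in> (\<lambda>y. a k y - a l y) ` C"
      by (simp add: bij_betw_def)
    then obtain y where y: "y \<in> C" "\<rho> s - \<rho> s' = a k y - a l y"
      by blast
    have "y \<in> \<kappa> ` {..<n}" "\<rho> s - a k y \<in> \<rho> ` {..<n}"
      using \<kappa> \<rho> y(1) by (simp_all add: bij_betw_def)
    then obtain i j where i: "i < n" "\<rho> s - a k y = \<rho> i" and j: "j < n" "y = \<kappa> j"
      by blast
    have "\<rho> i + a l y = \<rho> s'"
      using y(2) by (simp add: i(2)[symmetric] algebra_simps)
    then have "(L k i j, L l i j) = p"
      using p \<sigma>_\<rho> by (simp add: L_def i(2)[symmetric] j(2)[symmetric])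
    then show "p \<in> {(L k i j, L l i j) | i j. i < n \<and> j < n}"
      using i(1) j(1) by blast
  qed
  ultimately have "mols t n (\<lambda>_. {..<n}) L"
    by (simp add: mols_def)
  then show ?thesis
    by blast
qed

section \<open>Maps that are affine on cosets\<close>

text \<open>
  The set \<open>{..<m} \<times> UNIV\<close> is as large as the target, so injectivity suffices, and by additivity
  of \<open>\<psi>\<close> two equal values amount to an instance of the hypothesis \<open>disjoint\<close>.
  The case \<open>r = s\<close> of that hypothesis is injectivity of \<open>\<psi>\<close>; the case \<open>r \<noteq> s\<close> says
  that translates of the image of \<open>\<psi>\<close> with equal second component are disjoint.
\<close>

lemma bij_betw_affine_on_cosets:
  fixes \<psi> :: "'a::{ab_group_add, finite} \<Rightarrow> 'v::{ab_group_add, finite}"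
    and e :: "nat \<Rightarrow> 'v" and d :: "nat \<Rightarrow> 'h::finite"
  assumes additive: "\<And>x y. \<psi> (x - y) = \<psi> x - \<psi> y"
    and card_eq: "m * CARD('a) = CARD('v) * CARD('h)"
    and disjoint: "\<And>r s x. r < m \<Longrightarrow> s < m \<Longrightarrow> d r = d s \<Longrightarrow> e r - e s = \<psi> x \<Longrightarrow> r = s \<and> x = 0"
  shows "bij_betw (\<lambda>(r, x). (e r + \<psi> x, d r)) ({..<m} \<times> UNIV) UNIV"
proof -
  have inj: "inj_on (\<lambda>(r, x). (e r + \<psi> x, d r)) ({..<m} \<times> UNIV)"
  proof (rule inj_onI, clarsimp)
    fix r s x y
    assume "r < m" "s < m" "e r + \<psi> x = e s + \<psi> y" "d r = d s"
    then have "r = s \<and> y - x = 0"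
      by (intro disjoint) (auto simp: additive algebra_simps)
    then show "r = s \<and> x = y"
      by simp
  qed
  have "card ((\<lambda>(r, x). (e r + \<psi> x, d r)) ` ({..<m} \<times> UNIV)) = CARD('v \<times> 'h)"
    by (simp add: card_image[OF inj] card_cartesian_product card_eq)
  then have "(\<lambda>(r, x). (e r + \<psi> x, d r)) ` ({..<m} \<times> UNIV) = UNIV"
    by (intro card_subset_eq) auto
  with inj show ?thesis
    by (simp add: bij_betw_def)
qed

section \<open>Linear maps into the five-dimensional space over the field with two elements\<close>

type_synonym vec5 = "bit \<times> bit \<times> bit \<times> bit \<times> bit"

definition vec5_of_int :: "int \<Rightarrow> vec5" where
  "vec5_of_int k =
     (of_bool (odd k), of_bool (odd (k div 2)), of_bool (odd (k div 4)),
      of_bool (odd (k div 8)), of_bool (odd (k div 16)))"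

lemma card_bit: "CARD(bit) = 2"
proof -
  have "(UNIV :: bit set) = {0, 1}"
    by (auto intro: bit.exhaust)
  then have "CARD(bit) = card {0 :: bit, 1}"
    by (rule arg_cong)
  then show ?thesis
    by simp
qed

instance bit :: finite
  by standard (rule card_ge_0_finite, simp add: card_bit)

lemma vec5_minus: "v - w = v + w" for v w :: vec5
  by (cases v; cases w) simp

lemma vec5_add_self: "v + v = 0" for v :: vec5
  by (cases v) (simp add: zero_prod_def)

definition scale :: "bit \<Rightarrow> vec5 \<Rightarrow> vec5" where
  "scale x v = (if x = 0 then 0 else v)"

text \<open>The linear map on \<open>F\<^sub>2\<^sup>3\<close> with the given images of the standard basis.\<close>

fun linear_map :: "vec5 \<times> vec5 \<times> vec5 \<Rightarrow> bit \<times> bit \<times> bit \<Rightarrow> vec5" where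
  "linear_map (b0, b1, b2) (x0, x1, x2) = scale x0 b0 + scale x1 b1 + scale x2 b2"

lemma linear_map_minus: "linear_map b (x - y) = linear_map b x - linear_map b y"
proof -
  obtain b0 b1 b2 where b: "b = (b0, b1, b2)"
    by (rule prod_cases3)
  obtain x0 x1 x2 y0 y1 y2 where xy: "x = (x0, x1, x2)" "y = (y0, y1, y2)"
    by (rule prod_cases3[of x], rule prod_cases3[of y])
  have "scale (x + y) v = scale x v + scale y v" for x y v
    by (cases x; cases y) (simp_all add: scale_def vec5_add_self)
  then show ?thesis
    by (simp add: b xy vec5_minus ac_simps)
qed

lemma linear_map_minus_basis: "linear_map (b - b') x = linear_map b x - linear_map b' x"
proof -
  obtain b0 b1 b2 b0' b1' b2' where b: "b = (b0, b1, b2)" "b' = (b0', b1', b2')"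
    by (rule prod_cases3[of b], rule prod_cases3[of b'])
  obtain x0 x1 x2 where x: "x = (x0, x1, x2)"
    by (rule prod_cases3)
  have "scale x (v - w) = scale x v - scale x w" for x v w
    by (simp add: scale_def)
  then show ?thesis
    by (simp add: b x)
qed

fun nonzero_combinations :: "vec5 \<times> vec5 \<times> vec5 \<Rightarrow> vec5 list" where
  "nonzero_combinations (b0, b1, b2) = [b0, b1, b0 + b1, b2, b0 + b2, b1 + b2, b0 + b1 + b2]"

lemma linear_map_in_nonzero_combinations:
  assumes "x \<noteq> 0"
  shows "linear_map b x \<in> set (nonzero_combinations b)"
proof -
  obtain b0 b1 b2 x0 x1 x2 where bx: "b = (b0, b1, b2)" "x = (x0, x1, x2)"
    by (rule prod_cases3[of b], rule prod_cases3[of x])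
  then have "x0 = 1 \<or> x1 = 1 \<or> x2 = 1"
    using assms by (simp add: zero_prod_def)
  then show ?thesis
    unfolding bx by (cases x0; cases x1; cases x2) (simp_all add: scale_def)
qed

lemma of_int_mod3_eq_iff: "(of_int a :: 3) = of_int b \<longleftrightarrow> 3 dvd a - b"
proof -
  have "Rep_bit1 (of_int c :: 3) = c mod 3" for c
    using bit1.Rep_Abs_mod[where 'a = num1, of c] by (simp add: bit1.of_int_eq)
  then show ?thesis
    by (metis Rep_bit1_inject mod_eq_dvd_iff)
qed

section \<open>A difference matrix with twelve rows\<close>

text \<open>
  A row is given by the images of the standard basis under its linear part and by its entries in the
  columns \<open>(r, 0)\<close>. Residues modulo \<open>3\<close> are kept as integers, so that equality of residues is
  decided by divisibility.
\<close>

type_synonym affine_row = "(vec5 \<times> vec5 \<times> vec5) \<times> (vec5 \<times> int) list"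

fun separated :: "vec5 list \<Rightarrow> vec5 \<times> int \<Rightarrow> vec5 \<times> int \<Rightarrow> bool" where
  "separated W (e, d) (e', d') = (if 3 dvd d - d' then e - e' \<notin> set W else True)"

definition transversal :: "vec5 list \<Rightarrow> (vec5 \<times> int) list \<Rightarrow> bool" where
  "transversal W es \<longleftrightarrow> 0 \<notin> set W \<and> sorted_wrt (separated (0 # W)) es"

fun compatible :: "affine_row \<Rightarrow> affine_row \<Rightarrow> bool" where
  "compatible (b, es) (b', es') = transversal (nonzero_combinations (b - b')) (map2 (-) es es')"

fun row_entry :: "affine_row \<Rightarrow> nat \<times> (bit \<times> bit \<times> bit) \<Rightarrow> vec5 \<times> 3" where
  "row_entry (b, es) (r, x) = (fst (es ! r) + linear_map b x, of_int (snd (es ! r)))"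

text \<open>
  Since \<open>transversal\<close> compares every pair of entries in one order only, the other order is
  recovered from \<open>v - w = w - v\<close>.
\<close>

lemma bij_betw_row_entry_of_transversal:
  assumes trans: "transversal (nonzero_combinations b) es" and len: "length es = 12"
  shows "bij_betw (row_entry (b, es)) ({..<12} \<times> UNIV) UNIV"
proof -
  let ?W = "nonzero_combinations b"
  have image: "linear_map b x \<in> set (0 # ?W)" for x
  proof (cases "x = 0")
    case True
    then show ?thesis
      using linear_map_minus[of b 0 0] by simp
  qed (simp add: linear_map_in_nonzero_combinations)
  have less: False
    if "r < s" "s < 12" "3 dvd snd (es ! r) - snd (es ! s)"
      "fst (es ! r) - fst (es ! s) = linear_map b x" for r s x
  proof -
    have "separated (0 # ?W) (es ! r) (es ! s)"
      using trans that(1,2) len by (auto simp: transversal_def intro: sorted_wrt_nth_less)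
    then show False
      using that(3,4) image[of x] by (cases "es ! r"; cases "es ! s") simp
  qed
  have "bij_betw (\<lambda>(r, x). (fst (es ! r) + linear_map b x, of_int (snd (es ! r)) :: 3))
          ({..<12} \<times> UNIV) UNIV"
  proof (rule bij_betw_affine_on_cosets)
    show "12 * CARD(bit \<times> bit \<times> bit) = CARD(vec5) * CARD(3)"
      by (simp add: card_bit)
  next
    fix r s x
    assume rs: "r < 12" "s < 12"
      and d: "(of_int (snd (es ! r)) :: 3) = of_int (snd (es ! s))"
      and e: "fst (es ! r) - fst (es ! s) = linear_map b x"
    have e': "fst (es ! s) - fst (es ! r) = linear_map b x"
      using e by (simp add: vec5_minus add.commute)
    have "r = s"
      using less[of r s x] less[of s r x] rs d e e' of_int_mod3_eq_iff
      by (metis linorder_neqE_nat)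
    moreover have "x = 0"
    proof (rule ccontr)
      assume "x \<noteq> 0"
      then have "0 \<in> set ?W"
        using linear_map_in_nonzero_combinations[of x b] e \<open>r = s\<close> by simp
      then show False
        using trans by (simp add: transversal_def)
    qed
    ultimately show "r = s \<and> x = 0" ..
  qed (rule linear_map_minus)
  moreover have "row_entry (b, es) =
      (\<lambda>(r, x). (fst (es ! r) + linear_map b x, of_int (snd (es ! r)) :: 3))"
    by (simp add: fun_eq_iff)
  ultimately show ?thesis
    by simp
qed

text \<open>The difference of two rows is again of the form \<open>row_entry\<close>.\<close>

lemma bij_betw_row_entry_minus:
  assumes "compatible R R'" "length (snd R) = 12" "length (snd R') = 12"
  shows "bij_betw (\<lambda>y. row_entry R y - row_entry R' y) ({..<12} \<times> UNIV) UNIV"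
proof -
  obtain b es b' es' where R: "R = (b, es)" "R' = (b', es')"
    by (cases R; cases R')
  have "bij_betw (row_entry (b - b', map2 (-) es es')) ({..<12} \<times> UNIV) UNIV"
    using assms R by (intro bij_betw_row_entry_of_transversal) auto
  moreover have "row_entry (b - b', map2 (-) es es') y = row_entry R y - row_entry R' y"
    if "y \<in> {..<12} \<times> UNIV" for y
    using that assms R by (cases y) (simp add: linear_map_minus_basis algebra_simps)
  ultimately show ?thesis
    by (subst bij_betw_cong[symmetric])
qed

fun affine_row_of_ints :: "(int \<times> int \<times> int) \<times> (int \<times> int) list \<Rightarrow> affine_row" where
  "affine_row_of_ints ((b0, b1, b2), es) =
     ((vec5_of_int b0, vec5_of_int b1, vec5_of_int b2), map (map_prod vec5_of_int id) es)"

definition matrix_rows :: "affine_row list" where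
  "matrix_rows = map affine_row_of_ints
  [
   ((0, 0, 0),
    [(0,0), (0,0), (0,0), (0,0), (0,0), (0,0), (0,0), (0,0), (0,0), (0,0), (0,0), (0,0)]),
   ((1, 2, 4),
    [(0,0), (16,0), (24,0), (8,0), (24,1), (8,1), (0,1), (16,1), (0,2), (16,2), (8,2), (24,2)]),
   ((21, 6, 24),
    [(0,0), (22,2), (3,1), (25,0), (21,2), (11,1), (4,0), (18,2), (26,2), (31,1), (9,1), (8,0)]),
   ((3, 25, 12),
    [(0,0), (8,1), (5,0), (23,2), (4,0), (10,2), (13,1), (29,2), (19,1), (25,2), (26,1), (20,0)]),
   ((24, 8, 10),
    [(0,0), (17,0), (15,2), (26,1), (13,1), (7,0), (30,2), (24,2), (20,1), (1,1), (1,2), (28,0)]),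
   ((19, 7, 26),
    [(0,0), (26,2), (6,2), (5,2), (19,1), (16,1), (22,1), (4,2), (2,0), (15,0), (4,0), (1,1)]),
   ((31, 20, 2),
    [(0,0), (28,1), (24,2), (5,0), (23,0), (13,2), (23,2), (4,1), (31,2), (12,1), (6,0), (29,1)]),
   ((16, 24, 20),
    [(0,0), (14,0), (27,1), (12,2), (15,2), (11,0), (5,2), (24,1), (17,0), (22,2), (14,1), (9,1)]),
   ((27, 13, 8),
    [(0,0), (11,2), (10,0), (17,1), (25,2), (23,2), (21,0), (22,1), (9,1), (1,0), (19,2), (6,1)]),
   ((18, 3, 28),
    [(0,0), (15,2), (14,1), (19,1), (11,0), (25,1), (25,2), (21,0), (27,1), (14,2), (29,0), (4,2)]),
   ((20, 27, 18),
    [(0,0), (0,1), (30,2), (10,1), (6,2), (21,0), (31,1), (16,0), (1,2), (5,0), (28,1), (16,2)]),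
   ((14, 11, 16),
    [(0,0), (21,1), (4,1), (16,2), (9,1), (1,2), (28,0), (20,0), (22,0), (22,1), (18,2), (19,2)])
  ]"

lemma length_matrix_rows: "length matrix_rows = 12"
  by (simp add: matrix_rows_def)

lemma length_entries_matrix_rows: "R \<in> set matrix_rows \<Longrightarrow> length (snd R) = 12"
  by (auto simp: matrix_rows_def)

lemma matrix_rows_compatible: "sorted_wrt compatible matrix_rows"
  by code_simp

section \<open>Squares of order 96\<close>

lemma eleven_mols_96: "\<exists>(V :: nat \<Rightarrow> nat set) L. mols 11 96 V L"
proof (rule mols_of_difference_matrix)
  fix i j :: nat
  assume "i < j" "j \<le> 11"
  then have "compatible (matrix_rows ! i) (matrix_rows ! j)"
    using matrix_rows_compatible by (auto intro: sorted_wrt_nth_less simp: length_matrix_rows)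
  then show "bij_betw (\<lambda>y. row_entry (matrix_rows ! i) y - row_entry (matrix_rows ! j) y)
               ({..<12} \<times> UNIV) UNIV"
    using \<open>i < j\<close> \<open>j \<le> 11\<close>
    by (intro bij_betw_row_entry_minus length_entries_matrix_rows) (auto simp: length_matrix_rows)
qed (simp_all add: card_cartesian_product card_bit)

theorem theorem2:
  "max_mols 96 \<ge> 10 \<and>
   (\<exists>(V :: nat \<Rightarrow> nat set) (L :: nat \<Rightarrow> nat \<Rightarrow> nat \<Rightarrow> nat). mols 10 96 V L)"
proof
  show ex: "\<exists>(V :: nat \<Rightarrow> nat set) (L :: nat \<Rightarrow> nat \<Rightarrow> nat \<Rightarrow> nat). mols 10 96 V L"
    using eleven_mols_96 mols_antimono[where s = 10 and t = 11] by (meson numeral_le_iff semiring_norm)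
  have "enat 10 \<le> max_mols 96"
    unfolding max_mols_def using ex by (intro Sup_upper) blast
  then show "10 \<le> max_mols 96"
    by (simp add: numeral_eq_enat)
qed

end
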